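(* Let $M\in\mathbb{R}^{3\times 3}$ be a singular irreducible $F_0$-matrix. Then $M^{\#}\le 0$.
   Context: Inequalities between matrices are entrywise. A real square matrix is a $Z$-matrix if all its off-diagonal entries are nonpositive; any $Z$-matrix can be written as $A=sI-B$ with $s\in\mathbb{R}$ and $B\ge 0$. Let $\rho$ denote the spectral radius, and for $B\in\mathbb{R}^{m\times m}$ let $\rho_{m-1}(B)$ be the maximum of the spectral radii of the principal submatrices of $B$ of order $m-1$. A $Z$-matrix $A=sI-B$ ($B\ge0$) of order $m$ is an $M$-matrix if $s\ge\rho(B)$, and an $N_0$-matrix if $\rho_{m-1}(B)\le s<\rho(B)$. A $Z$-matrix of order $m\ge 3$ is an $F_0$-matrix if all its principal submatrices of orders at most $m-2$ are $M$-matrices and at least one principal submatrix of order $m-1$ is an $N_0$-matrix. The group inverse $M^{\#}$ of a square matrix $M$ is the unique matrix $X$, if it exists, with $MXM=M$, $XMX=X$, $MX=XM$; the assertion $M^{\#}\le 0$ means that the group inverse exists and is entrywise nonpositive. *)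

theory Defs
  imports
    "Jordan_Normal_Form.Spectral_Radius"
    "Jordan_Normal_Form.DL_Submatrix"
    "HOL-Combinatorics.Permutations"
begin

abbreviation rho :: "real mat \<Rightarrow> real" where
  "rho B \<equiv> spectral_radius (map_mat complex_of_real B)"

(* Index sets are sets of 0-based indices below dim_row A. *)
definition principal_submatrix :: "'a mat \<Rightarrow> nat set \<Rightarrow> 'a mat" where
  "principal_submatrix A I = submatrix A I I"

(* Meaningful for square matrices of order m \<ge> 2 only; spectral_radius is
   unspecified on the empty matrix. *)
definition rho_pred :: "real mat \<Rightarrow> real" where
  "rho_pred B = Max {rho (principal_submatrix B I) | I.
     I \<subseteq> {0..<dim_row B} \<and> card I = dim_row B - 1}"

definition Z_matrix :: "real mat \<Rightarrow> bool" where
  "Z_matrix A \<longleftrightarrow> square_mat A \<and>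
     (\<forall>i < dim_row A. \<forall>j < dim_row A. i \<noteq> j \<longrightarrow> A $$ (i, j) \<le> 0)"

definition Z_splitting :: "real mat \<Rightarrow> real \<Rightarrow> real mat \<Rightarrow> bool" where
  "Z_splitting A s B \<longleftrightarrow> B \<in> carrier_mat (dim_row A) (dim_row A) \<and>
     0\<^sub>m (dim_row A) (dim_row A) \<le> B \<and>
     A = s \<cdot>\<^sub>m 1\<^sub>m (dim_row A) - B"

(* Replacing (s, B) by (s + c, B + c I) shifts all spectral radii of nonnegative
   B by c, so "for some splitting" and "for every splitting" agree here and in
   N0_matrix. *)
definition M_matrix :: "real mat \<Rightarrow> bool" where
  "M_matrix A \<longleftrightarrow> Z_matrix A \<and> (\<exists>s B. Z_splitting A s B \<and> rho B \<le> s)"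

(* Order at least 2 is required so that rho_pred is meaningful. *)
definition N0_matrix :: "real mat \<Rightarrow> bool" where
  "N0_matrix A \<longleftrightarrow> Z_matrix A \<and> 2 \<le> dim_row A \<and>
     (\<exists>s B. Z_splitting A s B \<and> rho_pred B \<le> s \<and> s < rho B)"

definition F0_matrix :: "real mat \<Rightarrow> bool" where
  "F0_matrix A \<longleftrightarrow> Z_matrix A \<and> 3 \<le> dim_row A \<and>
     (\<forall>I \<subseteq> {0..<dim_row A}. 1 \<le> card I \<and> card I \<le> dim_row A - 2 \<longrightarrow>
        M_matrix (principal_submatrix A I)) \<and>
     (\<exists>I \<subseteq> {0..<dim_row A}. card I = dim_row A - 1 \<and>
        N0_matrix (principal_submatrix A I))"

(* A is reducible if some simultaneous permutation of rows and columns gives a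
   block upper triangular matrix with two square nonempty diagonal blocks. *)
definition reducible_mat :: "'a :: zero mat \<Rightarrow> bool" where
  "reducible_mat A \<longleftrightarrow>
     (\<exists>p r. p permutes {0..<dim_row A} \<and> 0 < r \<and> r < dim_row A \<and>
        (\<forall>i j. r \<le> i \<and> i < dim_row A \<and> j < r \<longrightarrow> A $$ (p i, p j) = 0))"

definition irreducible_mat :: "'a :: zero mat \<Rightarrow> bool" where
  "irreducible_mat A \<longleftrightarrow> square_mat A \<and> \<not> reducible_mat A"

definition singular_mat :: "'a :: semiring_1 mat \<Rightarrow> bool" where
  "singular_mat A \<longleftrightarrow> square_mat A \<and> \<not> invertible_mat A"

definition is_group_inverse :: "'a :: semiring_0 mat \<Rightarrow> 'a mat \<Rightarrow> bool" where
  "is_group_inverse M X \<longleftrightarrow> square_mat M \<and> X \<in> carrier_mat (dim_row M) (dim_row M) \<and>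
     M * X * M = M \<and> X * M * X = X \<and> M * X = X * M"

definition has_group_inverse :: "'a :: semiring_0 mat \<Rightarrow> bool" where
  "has_group_inverse M \<longleftrightarrow> (\<exists>X. is_group_inverse M X)"

definition group_inverse :: "'a :: semiring_0 mat \<Rightarrow> 'a mat" where
  "group_inverse M = (THE X. is_group_inverse M X)"

lemma is_group_inverse_unique:
  fixes M :: "'a :: semiring_0 mat"
  assumes "is_group_inverse M X" "is_group_inverse M Y"
  shows "X = Y"
proof -
  let ?n = "dim_row M"
  have M: "M \<in> carrier_mat ?n ?n" and X: "X \<in> carrier_mat ?n ?n" and Y: "Y \<in> carrier_mat ?n ?n"
    using assms by (auto simp: is_group_inverse_def)
  have x: "M * X * M = M" "X * M * X = X" "M * X = X * M"
    and y: "M * Y * M = M" "Y * M * Y = Y" "M * Y = Y * M"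
    using assms by (auto simp: is_group_inverse_def)
  have MX: "M * X \<in> carrier_mat ?n ?n" and YM: "Y * M \<in> carrier_mat ?n ?n"
    by (rule mult_carrier_mat[OF M X], rule mult_carrier_mat[OF Y M])
  have 1: "Y * M * M * X = Y * M * (M * X)" by (rule assoc_mult_mat[OF YM M X])
  have 2: "Y * M * (M * X) = Y * (M * (M * X))" by (rule assoc_mult_mat[OF Y M MX])
  have 3: "M * X * M = M * (X * M)" by (rule assoc_mult_mat[OF M X M])
  have 4: "Y * M * X = Y * (M * X)" by (rule assoc_mult_mat[OF Y M X])
  have 5: "Y * M * Y = Y * (M * Y)" by (rule assoc_mult_mat[OF Y M Y])
  have eq: "M * X = Y * M"
    using 1 2 3 x(1,3) y(1,3) by metis
  show ?thesis
    using 4 5 eq x(2,3) y(2,3) by metis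
qed

lemma group_inverse_eqI: "is_group_inverse M X \<Longrightarrow> group_inverse M = X"
  unfolding group_inverse_def using is_group_inverse_unique by blast

end

theory Submission
  imports Defs
begin

text \<open>
  The order-one condition makes the diagonal of \<open>M\<close> nonnegative, and the \<open>N\<^sub>0\<close> condition makes
  some \<open>2 \<times> 2\<close> principal minor, say on \<open>{j, k}\<close>, negative. Let \<open>i\<close> be the remaining index.
  As \<open>det M = 0\<close>, the adjugate has rank at most one, while its off-diagonal entries are nonnegative
  because \<open>M\<close> is a Z-matrix; a negative \<open>(i, i)\<close> entry therefore forces its \<open>(j, k)\<close> and \<open>(k, j)\<close>
  entries to vanish. With irreducibility this leaves, up to exchanging \<open>j\<close> and \<open>k\<close>, only matrices
  supported on row and column \<open>j\<close>, whose group inverse is explicit and visibly nonpositive.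
\<close>

section \<open>Determinants\<close>

text \<open>The expansion is invariant under simultaneous permutation of rows and columns, so
  indices can be labelled by their role instead of by 0, 1, 2.\<close>

lemma det_3:
  fixes A :: "'a :: comm_ring_1 mat"
  assumes A: "A \<in> carrier_mat 3 3"
    and ijk: "{..<3} = {i, j, k}" "distinct [i, j, k]"
  shows "det A = A $$ (i,i) * A $$ (j,j) * A $$ (k,k) + A $$ (i,j) * A $$ (j,k) * A $$ (k,i)
    + A $$ (i,k) * A $$ (j,i) * A $$ (k,j) - A $$ (i,i) * A $$ (j,k) * A $$ (k,j)
    - A $$ (i,j) * A $$ (j,i) * A $$ (k,k) - A $$ (i,k) * A $$ (j,j) * A $$ (k,i)"
proof -
  have det2: "det B = B $$ (0,0) * B $$ (1,1) - B $$ (0,1) * B $$ (1,0)"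
    if "B \<in> carrier_mat 2 2" for B :: "'a mat"
    using that by (subst laplace_expansion_row[OF that, of 0])
      (auto simp: numeral_2_eq_2 cofactor_def det_single mat_delete_def)
  have "det A = A $$ (0,0) * (A $$ (1,1) * A $$ (2,2) - A $$ (1,2) * A $$ (2,1))
    - A $$ (0,1) * (A $$ (1,0) * A $$ (2,2) - A $$ (1,2) * A $$ (2,0))
    + A $$ (0,2) * (A $$ (1,0) * A $$ (2,1) - A $$ (1,1) * A $$ (2,0))"
    using A by (subst laplace_expansion_row[OF A, of 0])
      (auto simp: numeral_3_eq_3 numeral_2_eq_2 lessThan_Suc cofactor_def det2 mat_delete_def algebra_simps)
  moreover have "(i,j,k) \<in> {(0,1,2),(0,2,1),(1,0,2),(1,2,0),(2,0,1),(2,1,0)}"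
  proof -
    have "i \<in> {..<3}" "j \<in> {..<3}" "k \<in> {..<3}" unfolding ijk(1) by simp_all
    then have "i \<in> {0,1,2}" "j \<in> {0,1,2}" "k \<in> {0,1,2}" by auto
    then show ?thesis using ijk(2) by (elim insertE emptyE) simp_all
  qed
  ultimately show ?thesis by (elim insertE emptyE) (simp_all add: algebra_simps)
qed

lemma det_eq_0_if_singular_mat:
  fixes A :: "'a :: field mat"
  assumes A: "A \<in> carrier_mat n n" and "singular_mat A"
  shows "det A = 0"
proof (rule ccontr)
  assume "det A \<noteq> 0"
  from det_non_zero_imp_unit[OF A this, of "()"]
  obtain B where "B \<in> carrier_mat n n" "A * B = 1\<^sub>m n" "B * A = 1\<^sub>m n"
    unfolding Units_def ring_mat_def by auto
  then have "invertible_mat A"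
    using A unfolding invertible_mat_def inverts_mat_def by auto
  with assms(2) show False unfolding singular_mat_def by simp
qed

section \<open>Principal submatrices, and entrywise consequences of the spectral conditions\<close>

lemma principal_submatrix_carrier:
  assumes "A \<in> carrier_mat n n" "I \<subseteq> {0..<n}"
  shows "principal_submatrix A I \<in> carrier_mat (card I) (card I)"
proof -
  have "{i. i < n \<and> i \<in> I} = I" using assms(2) by auto
  then show ?thesis
    using assms(1) unfolding principal_submatrix_def by (intro carrier_matI) (simp_all add: dim_submatrix)
qed

lemma principal_submatrix_index:
  assumes "A \<in> carrier_mat n n" "I \<subseteq> {0..<n}" "i < card I" "j < card I"
  shows "principal_submatrix A I $$ (i, j) = A $$ (pick I i, pick I j)"
proof -
  have "{i. i < n \<and> i \<in> I} = I" using assms(2) by auto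
  then show ?thesis using assms by (auto simp: principal_submatrix_def submatrix_def)
qed

text \<open>The single entry of \<open>B\<close> is an eigenvalue of \<open>B\<close>, hence at most
  \<open>rho B\<close> and so at most \<open>s\<close>.\<close>

lemma M_matrix_1_nonneg:
  assumes A: "A \<in> carrier_mat 1 1" and "M_matrix A"
  shows "0 \<le> A $$ (0, 0)"
proof -
  obtain s B where "Z_splitting A s B" and rho: "rho B \<le> s"
    using assms unfolding M_matrix_def by blast
  then have B: "B \<in> carrier_mat 1 1" and AB: "A = s \<cdot>\<^sub>m 1\<^sub>m 1 - B"
    using A by (auto simp: Z_splitting_def)
  let ?B = "map_mat complex_of_real B"
  have C: "?B \<in> carrier_mat 1 1" using B by simp
  have "eigenvalue ?B (complex_of_real (B $$ (0, 0)))"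
    unfolding eigenvalue_det[OF C]
    by (subst det_single) (use B in \<open>auto simp: char_matrix_def\<close>)
  then have "norm (complex_of_real (B $$ (0, 0))) \<le> rho B"
    by (intro spectral_radius_mem_max(2)[OF C] imageI) (auto simp: spectrum_def)
  then have "B $$ (0, 0) \<le> s" using rho by simp
  then show ?thesis using B by (simp add: AB)
qed

text \<open>A possibly complex eigenvalue \<open>l\<close> of modulus \<open>rho B\<close> satisfies
  \<open>(l - x) * (l - y) = p * r\<close>, and \<open>rho B > s\<close> makes the factors larger in
  modulus than the diagonal entries \<open>s - x\<close> and \<open>s - y\<close> of
  \<open>A\<close>.\<close>

lemma N0_matrix_2_det_neg:
  assumes A: "A \<in> carrier_mat 2 2" and "N0_matrix A"
    and nonneg: "0 \<le> A $$ (0, 0)" "0 \<le> A $$ (1, 1)"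
  shows "A $$ (0, 0) * A $$ (1, 1) < A $$ (0, 1) * A $$ (1, 0)"
proof -
  obtain s B where "Z_splitting A s B" and rho: "s < rho B"
    using assms unfolding N0_matrix_def by blast
  then have B: "B \<in> carrier_mat 2 2" and AB: "A = s \<cdot>\<^sub>m 1\<^sub>m 2 - B" and B0: "0\<^sub>m 2 2 \<le> B"
    using A by (auto simp: Z_splitting_def)
  let ?B = "map_mat complex_of_real B"
  have C: "?B \<in> carrier_mat 2 2" using B by simp
  obtain l where "eigenvalue ?B l" and l: "norm l = rho B"
    using spectral_radius_mem_max(1)[OF C] by (auto simp: spectrum_def)
  then obtain v where v: "v \<in> carrier_vec 2" "v \<noteq> 0\<^sub>v 2" "?B *\<^sub>v v = l \<cdot>\<^sub>v v"
    using B by (auto simp: eigenvalue_def eigenvector_def)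
  define x p r y where "x = B $$ (0,0)" and "p = B $$ (0,1)" and "r = B $$ (1,0)" and "y = B $$ (1,1)"
  define c d where "c = v $ 0" and "d = v $ 1"
  have A_entries: "A $$ (0,0) = s - x" "A $$ (0,1) = - p" "A $$ (1,0) = - r" "A $$ (1,1) = s - y"
    using B by (auto simp: AB x_def p_def r_def y_def)
  have pos: "0 \<le> x" "0 \<le> p" "0 \<le> r" "0 \<le> y"
    using B0 B by (auto simp: less_eq_mat_def x_def p_def r_def y_def)
  have e0: "of_real x * c + of_real p * d = l * c"
    using arg_cong[OF v(3), of "\<lambda>w. w $ 0"] v(1) B
    by (auto simp: scalar_prod_def numeral_2_eq_2 c_def d_def x_def p_def)
  have e1: "of_real r * c + of_real y * d = l * d"
    using arg_cong[OF v(3), of "\<lambda>w. w $ 1"] v(1) B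
    by (auto simp: scalar_prod_def numeral_2_eq_2 c_def d_def r_def y_def)
  have c: "(l - of_real x) * c = of_real p * d" and d: "(l - of_real y) * d = of_real r * c"
    using e0 e1 by (simp_all add: algebra_simps)
  \<comment> \<open>Eliminating the other coordinate shows that the characteristic polynomial at
    \<open>l\<close> annihilates each coordinate of the eigenvector, one of which is
    nonzero.\<close>
  have "((l - of_real x) * (l - of_real y) - of_real p * of_real r) * c
      = (l - of_real y) * ((l - of_real x) * c) - of_real p * (of_real r * c)"
    by (simp add: algebra_simps)
  also have "\<dots> = 0" unfolding c d[symmetric] by (simp add: algebra_simps)
  finally have "((l - of_real x) * (l - of_real y) - of_real p * of_real r) * c = 0" .
  moreover have "((l - of_real x) * (l - of_real y) - of_real p * of_real r) * d
      = (l - of_real x) * ((l - of_real y) * d) - of_real r * (of_real p * d)"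
    by (simp add: algebra_simps)
  then have "((l - of_real x) * (l - of_real y) - of_real p * of_real r) * d = 0"
    unfolding d c[symmetric] by (simp add: algebra_simps)
  moreover have "c \<noteq> 0 \<or> d \<noteq> 0"
  proof (rule ccontr)
    assume "\<not> (c \<noteq> 0 \<or> d \<noteq> 0)"
    then have "v = 0\<^sub>v 2" using v(1) by (intro eq_vecI) (auto simp: c_def d_def less_2_cases_iff)
    with v(2) show False by simp
  qed
  ultimately have "(l - of_real x) * (l - of_real y) = of_real p * of_real r"
    by auto
  then have eq: "norm (l - of_real x) * norm (l - of_real y) = p * r"
    using pos by (metis abs_of_nonneg norm_mult norm_of_real)
  \<comment> \<open>Reverse triangle inequality:
    \<open>norm (l - x) \<ge> rho B - x > s - x\<close>.\<close>
  have "s - x < norm (l - of_real x)" "s - y < norm (l - of_real y)"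
    using norm_triangle_ineq2[of l "of_real x"] norm_triangle_ineq2[of l "of_real y"] pos l rho
    by auto
  then have "(s - x) * (s - y) < norm (l - of_real x) * norm (l - of_real y)"
    using nonneg unfolding A_entries by (intro mult_strict_mono') auto
  then show ?thesis unfolding A_entries using eq by simp
qed

section \<open>Irreducibility\<close>

text \<open>Otherwise moving \<open>i\<close> to the last position gives a block triangular form
  whose lower diagonal block has order one.\<close>

lemma irreducible_mat_row_nonzero:
  assumes A: "A \<in> carrier_mat n n" "irreducible_mat A" and n: "2 \<le> n" "i < n"
  shows "\<exists>j<n. j \<noteq> i \<and> A $$ (i, j) \<noteq> 0"
proof (rule ccontr)
  assume H: "\<not> ?thesis"
  let ?p = "Transposition.transpose i (n - 1)"
  have "?p permutes {0..<n}" using n by (intro permutes_swap_id) auto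
  moreover have "A $$ (?p a, ?p b) = 0" if "n - 1 \<le> a" "a < n" "b < n - 1" for a b
  proof -
    have "a = n - 1" using that by simp
    then have "?p a = i" by simp
    moreover have "?p b \<noteq> i" "?p b < n" using that n by (auto simp: Transposition.transpose_def)
    ultimately show ?thesis using H by auto
  qed
  ultimately have "reducible_mat A"
    unfolding reducible_mat_def using A(1) n by (intro exI[of _ ?p] exI[of _ "n - 1"]) auto
  then show False using A(2) by (simp add: irreducible_mat_def)
qed

text \<open>Dually, \<open>i\<close> moves to the first position and the upper diagonal block has
  order one.\<close>

lemma irreducible_mat_col_nonzero:
  assumes A: "A \<in> carrier_mat n n" "irreducible_mat A" and n: "2 \<le> n" "i < n"
  shows "\<exists>j<n. j \<noteq> i \<and> A $$ (j, i) \<noteq> 0"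
proof (rule ccontr)
  assume H: "\<not> ?thesis"
  let ?p = "Transposition.transpose i 0"
  have "?p permutes {0..<n}" using n by (intro permutes_swap_id) auto
  moreover have "A $$ (?p a, ?p b) = 0" if "1 \<le> a" "a < n" "b < 1" for a b
  proof -
    have "?p b = i" using that by simp
    moreover have "?p a \<noteq> i" "?p a < n" using that n by (auto simp: Transposition.transpose_def)
    ultimately show ?thesis using H by auto
  qed
  ultimately have "reducible_mat A"
    unfolding reducible_mat_def using A(1) n by (intro exI[of _ ?p] exI[of _ 1]) auto
  then show False using A(2) by (simp add: irreducible_mat_def)
qed

section \<open>Zero pattern and group inverse\<close>

text \<open>The variables are the entries of the matrix with rows \<open>(a, p, q)\<close>,
  \<open>(r, b, t)\<close>, \<open>(u, v, c)\<close>, indexed by \<open>i\<close>, \<open>j\<close>,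
  \<open>k\<close>.\<close>

lemma singular_Z_pattern:
  fixes a b c p q r t u v :: real
  assumes nonneg: "0 \<le> a" "0 \<le> b" "0 \<le> c"
    and nonpos: "p \<le> 0" "q \<le> 0" "r \<le> 0" "t \<le> 0" "u \<le> 0" "v \<le> 0"
    and det: "a * b * c + p * t * u + q * r * v - a * t * v - p * r * c - q * b * u = 0"
    and neg: "b * c < t * v"
    and row: "p \<noteq> 0 \<or> q \<noteq> 0" and col: "r \<noteq> 0 \<or> u \<noteq> 0"
  shows "a = 0 \<and> (q = 0 \<and> u = 0 \<and> c = 0 \<and> 0 < p * r \<or> p = 0 \<and> r = 0 \<and> b = 0 \<and> 0 < q * u)"
proof -
  \<comment> \<open>The first four are off-diagonal adjugate entries. The other four split the
    \<open>(j, k)\<close> and \<open>(k, j)\<close> entries \<open>q * r - a * t\<close> and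
    \<open>p * u - a * v\<close> into signed terms, since each term will have to vanish.\<close>
  have cofactors: "0 \<le> p * t - q * b" "0 \<le> t * u - r * c" "0 \<le> r * v - b * u"
      "0 \<le> q * v - p * c" "0 \<le> q * r" "a * t \<le> 0" "0 \<le> p * u" "a * v \<le> 0"
    using mult_nonpos_nonpos[OF nonpos(1,4)] mult_nonpos_nonneg[OF nonpos(2) nonneg(2)]
      mult_nonpos_nonpos[OF nonpos(4,5)] mult_nonpos_nonneg[OF nonpos(3) nonneg(3)]
      mult_nonpos_nonpos[OF nonpos(3,6)] mult_nonneg_nonpos[OF nonneg(2) nonpos(5)]
      mult_nonpos_nonpos[OF nonpos(2,6)] mult_nonpos_nonneg[OF nonpos(1) nonneg(3)]
      mult_nonpos_nonpos[OF nonpos(2,3)] mult_nonneg_nonpos[OF nonneg(1) nonpos(4)]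
      mult_nonpos_nonpos[OF nonpos(1,5)] mult_nonneg_nonpos[OF nonneg(1) nonpos(6)]
    by auto
  \<comment> \<open>The \<open>2 \<times> 2\<close> minors of the adjugate are multiples of the determinant.\<close>
  have "(t * v - b * c) * (q * r - a * t) + (p * t - q * b) * (t * u - r * c)
      = t * (a * b * c + p * t * u + q * r * v - a * t * v - p * r * c - q * b * u)"
    by (simp add: algebra_simps)
  moreover have "0 \<le> (p * t - q * b) * (t * u - r * c)" using cofactors by simp
  ultimately have "(t * v - b * c) * (q * r - a * t) \<le> 0" unfolding det by simp
  \<comment> \<open>The factor \<open>t * v - b * c\<close> is positive. The other factor is a sum
    of two nonnegative terms, so both are zero.\<close>
  then have "q * r - a * t \<le> 0" using neg by (simp add: mult_le_0_iff)
  then have 1: "q * r = 0" "a * t = 0" using cofactors by linarith+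
  have "(t * v - b * c) * (p * u - a * v) + (r * v - b * u) * (q * v - p * c)
      = v * (a * b * c + p * t * u + q * r * v - a * t * v - p * r * c - q * b * u)"
    by (simp add: algebra_simps)
  moreover have "0 \<le> (r * v - b * u) * (q * v - p * c)" using cofactors by simp
  ultimately have "(t * v - b * c) * (p * u - a * v) \<le> 0" unfolding det by simp
  then have "p * u - a * v \<le> 0" using neg by (simp add: mult_le_0_iff)
  then have 2: "p * u = 0" "a * v = 0" using cofactors by linarith+
  have "t \<noteq> 0" using neg mult_nonneg_nonneg[OF nonneg(2,3)] by auto
  then have a: "a = 0" using 1 by simp
  show ?thesis
  proof (cases "p = 0")
    case True
    then have "q \<noteq> 0" using row by simp
    then have "r = 0" using 1 by simp
    then have "u \<noteq> 0" using col by simp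
    \<comment> \<open>The determinant has shrunk to \<open>- q * b * u\<close>.\<close>
    then have "b = 0" using det True a \<open>r = 0\<close> \<open>q \<noteq> 0\<close> by simp
    then show ?thesis using a True \<open>r = 0\<close> \<open>q \<noteq> 0\<close> \<open>u \<noteq> 0\<close> nonpos
      by (auto intro: mult_neg_neg)
  next
    case False
    then have "u = 0" using 2 by simp
    then have "r \<noteq> 0" using col by simp
    then have "q = 0" using 1 by simp
    then have "c = 0" using det False a \<open>u = 0\<close> \<open>r \<noteq> 0\<close> by simp
    then show ?thesis using a False \<open>u = 0\<close> \<open>q = 0\<close> \<open>r \<noteq> 0\<close> nonpos
      by (auto intro: mult_neg_neg)
  qed
qed

text \<open>Here \<open>j\<close> is the centre of a star with leaves \<open>i\<close> and
  \<open>k\<close>. The characteristic polynomial is \<open>x^3 - b * x^2 - e * x\<close>, whose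
  root 0 is simple as \<open>e > 0\<close>. In the resulting inverse the edges are divided by
  \<open>e\<close>, the centre entry cancels, and leaf-to-leaf entries are
  \<open>- b / e\<^sup>2\<close> times a product of two nonpositive edges.\<close>

lemma group_inverse_nonpos_star:
  fixes M :: "real mat"
  assumes M: "M \<in> carrier_mat 3 3"
    and ijk: "{..<3} = {i, j, k}" "distinct [i, j, k]"
    and zero: "M $$ (i,i) = 0" "M $$ (i,k) = 0" "M $$ (k,i) = 0" "M $$ (k,k) = 0"
    and nonneg: "0 \<le> M $$ (j,j)"
    and nonpos: "M $$ (i,j) \<le> 0" "M $$ (j,i) \<le> 0" "M $$ (j,k) \<le> 0" "M $$ (k,j) \<le> 0"
    and pos: "0 < M $$ (i,j) * M $$ (j,i) + M $$ (j,k) * M $$ (k,j)"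
  shows "has_group_inverse M \<and> group_inverse M \<le> 0\<^sub>m 3 3"
proof -
  define e where "e = M $$ (i,j) * M $$ (j,i) + M $$ (j,k) * M $$ (k,j)"
  define b where "b = M $$ (j,j)"
  \<comment> \<open>Since \<open>M\<^sup>3 = b M\<^sup>2 + e M\<close>, the group inverse is \<open>M (M - b)\<^sup>2 / e\<^sup>2\<close>.\<close>
  define f where "f x y = ((e + b\<^sup>2) * M $$ (x,y) - b * (\<Sum>z<3. M $$ (x,z) * M $$ (z,y))) / e\<^sup>2" for x y
  define X where "X = mat 3 3 (\<lambda>(x,y). f x y)"
  have X: "X \<in> carrier_mat 3 3" by (simp add: X_def)
  have lt: "x < 3 \<longleftrightarrow> x = i \<or> x = j \<or> x = k" for x
    using ijk(1) by (auto simp flip: lessThan_iff)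
  have sum3: "(\<Sum>z<3. g z) = g i + g j + g k" for g :: "nat \<Rightarrow> real"
    unfolding ijk(1) using ijk(2) by (simp add: add.assoc)
  have mult: "(A * B) $$ (x,y) = A $$ (x,i) * B $$ (i,y) + A $$ (x,j) * B $$ (j,y) + A $$ (x,k) * B $$ (k,y)"
    if "A \<in> carrier_mat 3 3" "B \<in> carrier_mat 3 3" "x < 3" "y < 3" for A B :: "real mat" and x y
    using that by (simp add: scalar_prod_def atLeast0LessThan sum3 lt)
  have e: "e \<noteq> 0" using pos e_def by simp
  define p r t v where "p = M $$ (i,j)" and "r = M $$ (j,i)" and "t = M $$ (j,k)" and "v = M $$ (k,j)"
  note Ms = zero b_def[symmetric] p_def[symmetric] r_def[symmetric] t_def[symmetric] v_def[symmetric]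
  have e_eq: "e = p * r + t * v" by (simp add: e_def Ms)
  then have tv: "t * v = e - p * r" by simp
  have Xs: "X $$ (i,i) = - (b * (p * r)) / e\<^sup>2" "X $$ (i,j) = p / e" "X $$ (i,k) = - (b * (p * t)) / e\<^sup>2"
    "X $$ (j,i) = r / e" "X $$ (j,j) = 0" "X $$ (j,k) = t / e"
    "X $$ (k,i) = - (b * (v * r)) / e\<^sup>2" "X $$ (k,j) = v / e" "X $$ (k,k) = - (b * (v * t)) / e\<^sup>2"
    using e tv by (auto simp: X_def f_def sum3 lt Ms field_simps power2_eq_square)
  have MX: "M * X \<in> carrier_mat 3 3" "X * M \<in> carrier_mat 3 3" using M X by auto
  \<comment> \<open>The idempotent \<open>M * X\<close> fixes coordinate \<open>j\<close> and has on
    \<open>i\<close>, \<open>k\<close> the rank-one block with column \<open>(p, v)\<close> and row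
    \<open>(r, t) / e\<close>. Denominators are cleared with \<open>e\<close> atomic, and only then
    is \<open>e\<close> expanded.\<close>
  have MXs: "(M * X) $$ (i,i) = p * r / e" "(M * X) $$ (i,j) = 0" "(M * X) $$ (i,k) = p * t / e"
    "(M * X) $$ (j,i) = 0" "(M * X) $$ (j,j) = 1" "(M * X) $$ (j,k) = 0"
    "(M * X) $$ (k,i) = v * r / e" "(M * X) $$ (k,j) = 0" "(M * X) $$ (k,k) = v * t / e"
    using e M X by (simp_all add: mult lt Ms Xs field_simps power2_eq_square del: index_mult_mat(1);
      simp add: e_eq algebra_simps)+
  have XMs: "(X * M) $$ (i,i) = p * r / e" "(X * M) $$ (i,j) = 0" "(X * M) $$ (i,k) = p * t / e"
    "(X * M) $$ (j,i) = 0" "(X * M) $$ (j,j) = 1" "(X * M) $$ (j,k) = 0"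
    "(X * M) $$ (k,i) = v * r / e" "(X * M) $$ (k,j) = 0" "(X * M) $$ (k,k) = v * t / e"
    using e M X by (simp_all add: mult lt Ms Xs field_simps power2_eq_square del: index_mult_mat(1);
      simp add: e_eq algebra_simps)+
  have MXM: "(M * X * M) $$ (x,y) = M $$ (x,y)" if "x < 3" "y < 3" for x y
    using that e unfolding mult[OF MX(1) M that] lt
    by (elim disjE; simp add: MXs Ms field_simps; simp add: e_eq algebra_simps)
  have XMX: "(X * M * X) $$ (x,y) = X $$ (x,y)" if "x < 3" "y < 3" for x y
    using that e unfolding mult[OF MX(2) X that] lt
    by (elim disjE; simp add: XMs Xs field_simps power2_eq_square; simp add: e_eq algebra_simps)
  have comm: "(M * X) $$ (x,y) = (X * M) $$ (x,y)" if "x < 3" "y < 3" for x y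
    using that unfolding lt by (elim disjE; simp only: MXs XMs)
  have "is_group_inverse M X"
    using M X MXM XMX comm unfolding is_group_inverse_def
    by (intro conjI eq_matI) (simp_all del: index_mult_mat(1) assoc_mult_mat)
  moreover have "X \<le> 0\<^sub>m 3 3"
    using nonneg nonpos pos X unfolding less_eq_mat_def e_def[symmetric]
    by (auto simp: lt Xs Ms divide_le_0_iff mult_nonpos_nonpos)
  ultimately show ?thesis
    using group_inverse_eqI unfolding has_group_inverse_def by metis
qed

theorem theorem4p3:
  fixes M :: "real mat"
  assumes "M \<in> carrier_mat 3 3"
    and "singular_mat M"
    and "irreducible_mat M"
    and "F0_matrix M"
  shows "has_group_inverse M \<and> group_inverse M \<le> 0\<^sub>m 3 3"
proof -
  note M = assms(1)
  have Z: "M $$ (x, y) \<le> 0" if "x < 3" "y < 3" "x \<noteq> y" for x y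
    using assms(4) M that by (auto simp: F0_matrix_def Z_matrix_def)
  have diag: "0 \<le> M $$ (x, x)" if x: "x < 3" for x
  proof -
    have I: "{x} \<subseteq> {0..<3}" using x by simp
    \<comment> \<open>For order 3 the bound \<open>dim_row M - 2\<close> is 1, so singletons
      qualify.\<close>
    then have "M_matrix (principal_submatrix M {x})"
      using assms(4) M by (auto simp: F0_matrix_def)
    then have "0 \<le> principal_submatrix M {x} $$ (0, 0)"
      using M_matrix_1_nonneg principal_submatrix_carrier[OF M I] by simp
    moreover have "pick {x} 0 = x" by (simp add: Least_equality)
    ultimately show ?thesis by (simp add: principal_submatrix_index[OF M I] del: pick.simps)
  qed
  obtain I where I: "I \<subseteq> {0..<3}" "card I = 2" and N0: "N0_matrix (principal_submatrix M I)"
    using assms(4) M by (auto simp: F0_matrix_def)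
  \<comment> \<open>\<open>pick\<close> enumerates \<open>I\<close> increasingly, so
    \<open>j\<close> and \<open>k\<close> are the indices behind rows 0 and 1 of the
    submatrix.\<close>
  define j k where "j = pick I 0" and "k = pick I 1"
  have jk: "j \<in> I" "k \<in> I" "j < k"
    using I by (auto simp: j_def k_def intro: pick_in_set_le pick_mono_le simp del: pick.simps)
  then have lt: "j < 3" "k < 3" using I by auto
  have neg: "M $$ (j,j) * M $$ (k,k) < M $$ (j,k) * M $$ (k,j)"
    using N0_matrix_2_det_neg[OF _ N0] principal_submatrix_carrier[OF M I(1)]
      principal_submatrix_index[OF M I(1)] diag lt I(2)
    by (simp add: j_def k_def del: pick.simps)
  obtain i where ijk: "{..<3} = {i, j, k}" "distinct [i, j, k]"
  \<comment> \<open>The three indices 0, 1, 2 add up to 3.\<close>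
  proof (rule that[of "3 - j - k"])
    have "(j,k) \<in> {(0,1),(0,2),(1,2)}" using lt \<open>j < k\<close> by auto
    then show "{..<3} = {3 - j - k, j, k}" "distinct [3 - j - k, j, k]"
      by (auto simp: numeral_3_eq_3)
  qed
  have all: "x < 3 \<longleftrightarrow> x = i \<or> x = j \<or> x = k" for x
    using ijk(1) by (auto simp flip: lessThan_iff)
  have "M $$ (i,j) \<noteq> 0 \<or> M $$ (i,k) \<noteq> 0"
    using irreducible_mat_row_nonzero[OF M assms(3), of i] by (auto simp: all)
  moreover have "M $$ (j,i) \<noteq> 0 \<or> M $$ (k,i) \<noteq> 0"
    using irreducible_mat_col_nonzero[OF M assms(3), of i] by (auto simp: all)
  ultimately have pattern: "M $$ (i,i) = 0 \<and>
      (M $$ (i,k) = 0 \<and> M $$ (k,i) = 0 \<and> M $$ (k,k) = 0 \<and> 0 < M $$ (i,j) * M $$ (j,i) \<or>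
       M $$ (i,j) = 0 \<and> M $$ (j,i) = 0 \<and> M $$ (j,j) = 0 \<and> 0 < M $$ (i,k) * M $$ (k,i))"
    using det_eq_0_if_singular_mat[OF M assms(2)] det_3[OF M ijk] ijk(2) neg
    by (intro singular_Z_pattern[where t = "M $$ (j,k)" and v = "M $$ (k,j)"]) (auto simp: diag Z all)
  have pos: "0 < M $$ (j,k) * M $$ (k,j)"
    using neg diag lt by (meson le_less_trans mult_nonneg_nonneg)
  from pattern show ?thesis
  proof (elim conjE disjE)
    assume "M $$ (i,i) = 0" "M $$ (i,k) = 0" "M $$ (k,i) = 0" "M $$ (k,k) = 0"
      "0 < M $$ (i,j) * M $$ (j,i)"
    then show ?thesis
      using pos ijk(2) by (intro group_inverse_nonpos_star[OF M ijk]) (auto simp: diag Z all)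
  next
    \<comment> \<open>Now \<open>k\<close> is the centre of the star, and \<open>i\<close> and
      \<open>j\<close> are its leaves.\<close>
    assume "M $$ (i,i) = 0" "M $$ (i,j) = 0" "M $$ (j,i) = 0" "M $$ (j,j) = 0"
      "0 < M $$ (i,k) * M $$ (k,i)"
    then show ?thesis
      using pos ijk by (intro group_inverse_nonpos_star[OF M, of i k j]) (auto simp: diag Z all mult.commute)
  qed
qed

end
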